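(* Let $p$ be a prime number, let $r$ be a positive integer, let $\Delta \subset \mathbb{R}^d$ be a $d$-dimensional Gorenstein simplex of index $r$ whose normalized volume equals $p^2$, and let $t$ be the unique interior lattice point of $r\Delta$. (1) Suppose that $s$ is an integer with $0 \le s \le d-1$ such that $rp^2-1 = (d-s)+ps$ and, for some ordering of the vertices of $\Delta$, $\Lambda_\Delta$ is generated by $$\Big(\underbrace{\tfrac{1}{p},\ldots,\tfrac{1}{p}}_{s},\underbrace{\tfrac{1}{p^2},\ldots,\tfrac{1}{p^2}}_{d-s+1}\Big).$$ Then $\mathrm{Vol}((r\Delta - t)^\vee) = rp^{2d-s}$. (2) Suppose that $d = rp-1$ and there exist an integer $s$ with $1 \le s \le d-1$ and integers $1 \le a_1,\ldots,a_{s-1} \le p-1$ such that, for some ordering of the vertices of $\Delta$, $\Lambda_\Delta$ is generated by the two elements $$\Big(\tfrac{2 - \sum_{1\le i\le s-1} a_i}{p}, \tfrac{a_1+1}{p},\ldots,\tfrac{a_{s-1}+1}{p}, 0, \underbrace{\tfrac1p,\ldots,\tfrac1p}_{d-s}\Big)$$ and $$\Big(\tfrac{(\sum_{1\le i\le s-1} a_i) - 1}{p}, \tfrac{p-a_1}{p},\ldots,\tfrac{p-a_{s-1}}{p}, \tfrac1p, \underbrace{0,\ldots,0}_{d-s}\Big)$$ of $(\mathbb{R}/\mathbb{Z})^{d+1}$. Then $\mathrm{Vol}((r\Delta - t)^\vee) = rp^{d-1}$.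
   Context: A lattice polytope is a convex polytope all of whose vertices have integer coordinates. $\mathrm{Vol}(\mathcal{P})$ denotes the normalized volume, i.e. $d!$ times the Euclidean volume of a $d$-dimensional lattice polytope $\mathcal{P}\subset\mathbb{R}^d$. For a $d$-dimensional lattice simplex $\Delta \subset \mathbb{R}^d$ with (ordered) vertices $v_0,\ldots,v_d \in \mathbb{Z}^d$, define the finite abelian group $$\Lambda_\Delta = \{(\lambda_0,\ldots,\lambda_d) \in (\mathbb{R}/\mathbb{Z})^{d+1} : \textstyle\sum_{i=0}^d \lambda_i (v_i,1) \in \mathbb{Z}^{d+1}\}$$ with componentwise addition. The dual polytope of $\mathcal{Q}\subset\mathbb{R}^d$ is $\mathcal{Q}^\vee = \{y \in \mathbb{R}^d : \langle x,y\rangle \le 1 \text{ for all } x \in \mathcal{Q}\}$. A $d$-dimensional lattice polytope $\mathcal{Q}$ is reflexive if the origin is the unique lattice point in its interior and $\mathcal{Q}^\vee$ is also a lattice polytope. A $d$-dimensional lattice polytope $\mathcal{P} \subset \mathbb{R}^d$ is Gorenstein of index $r$ ($r \in \mathbb{Z}_{>0}$) if there exist a reflexive polytope $\mathcal{Q} \subset \mathbb{R}^d$ and $w \in \mathbb{Z}^d$ with $\mathcal{Q} = r\mathcal{P} + w$; then $r\mathcal{P}$ has a unique interior lattice point $t$ and $\mathcal{Q} = r\mathcal{P} - t$. A Gorenstein simplex is a lattice simplex that is Gorenstein. *)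

theory Defs
  imports "HOL-Analysis.Analysis" "HOL-Algebra.Product_Groups"
    "HOL-Computational_Algebra.Primes"
begin

definition int_lattice :: "(real ^ 'n::finite) set" where
  "int_lattice = {x. \<forall>i. x $ i \<in> \<int>}"

definition vertex_set :: "(real ^ 'n::finite) set \<Rightarrow> (real ^ 'n) set" where
  "vertex_set P = {x. x extreme_point_of P}"

definition lattice_polytope :: "(real ^ 'n::finite) set \<Rightarrow> bool" where
  "lattice_polytope P \<longleftrightarrow> polytope P \<and> vertex_set P \<subseteq> int_lattice"

text \<open>Meant for polytopes whose dimension is that of the ambient space.\<close>

definition normalized_volume :: "(real ^ 'n::finite) set \<Rightarrow> real" where
  "normalized_volume P = fact CARD('n) * measure lebesgue P"

definition dual_polytope :: "(real ^ 'n::finite) set \<Rightarrow> (real ^ 'n) set" where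
  "dual_polytope Q = {y. \<forall>x\<in>Q. x \<bullet> y \<le> 1}"

definition reflexive_polytope :: "(real ^ 'n::finite) set \<Rightarrow> bool" where
  "reflexive_polytope Q \<longleftrightarrow>
     lattice_polytope Q \<and> aff_dim Q = int CARD('n) \<and>
     interior Q \<inter> int_lattice = {0} \<and> lattice_polytope (dual_polytope Q)"

definition gorenstein :: "nat \<Rightarrow> (real ^ 'n::finite) set \<Rightarrow> bool" where
  "gorenstein r P \<longleftrightarrow>
     r > 0 \<and> lattice_polytope P \<and> aff_dim P = int CARD('n) \<and>
     (\<exists>Q w. reflexive_polytope Q \<and> w \<in> int_lattice \<and> Q = (\<lambda>x. real r *\<^sub>R x + w) ` P)"

definition gorenstein_simplex :: "nat \<Rightarrow> (real ^ 'n::finite) set \<Rightarrow> bool" where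
  "gorenstein_simplex r P \<longleftrightarrow> gorenstein r P \<and> int CARD('n) simplex P"

definition real_add_group :: "real monoid" where
  "real_add_group = \<lparr>carrier = UNIV, monoid.mult = (+), one = 0\<rparr>"

text \<open>The group \<open>(\<real>/\<int>)\<^bsup>d+1\<^esup>\<close>, with coordinates indexed by \<open>0, \<dots>, d\<close>; a coordinate
  is a coset of \<open>\<int>\<close> in \<open>\<real>\<close>.\<close>

definition torus :: "nat \<Rightarrow> (nat \<Rightarrow> real set) monoid" where
  "torus d = product_group {0..d} (\<lambda>_. real_add_group Mod \<int>)"

definition to_torus :: "nat \<Rightarrow> (nat \<Rightarrow> real) \<Rightarrow> (nat \<Rightarrow> real set)" where
  "to_torus d x = (\<lambda>i\<in>{0..d}. \<int> #>\<^bsub>real_add_group\<^esub> x i)"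

definition vertex_ordering :: "(real ^ 'n::finite) set \<Rightarrow> (nat \<Rightarrow> real ^ 'n) \<Rightarrow> bool" where
  "vertex_ordering P v \<longleftrightarrow> bij_betw v {0..CARD('n)} (vertex_set P)"

text \<open>The defining condition is stated for a real lift \<open>x\<close> of \<open>\<lambda>\<close>; when all \<open>v i\<close> are
  lattice points, it does not depend on the choice of the lift.\<close>

definition Lambda :: "(nat \<Rightarrow> real ^ 'n::finite) \<Rightarrow> (nat \<Rightarrow> real set) set" where
  "Lambda v = {to_torus CARD('n) x | x.
     (\<Sum>i=0..CARD('n). x i *\<^sub>R (v i, 1 :: real)) \<in> int_lattice \<times> \<int>}"

end

theory Submission
  imports Defs
begin

text \<open>Everything rests on the barycentric coordinates of \<open>t\<close>. If a class in \<open>\<Lambda>\<^sub>\<Delta>\<close> has a real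
  lift \<open>x\<close> with all \<open>x\<^sub>i > 0\<close> and \<open>\<Sum> x\<^sub>i = r\<close>, then \<open>\<Sum> x\<^sub>i v\<^sub>i\<close> is a lattice point in the interior of
  \<open>r\<Delta>\<close>, so it is \<open>t\<close>. Such a lift can be read off from the given generators. In (1) the generator
  itself is one: its coordinates add up to \<open>(ps + d - s + 1)/p\<^sup>2 = r\<close>. In (2) the two generators
  add up to the class of \<open>(1/p, \<dots>, 1/p)\<close>, and \<open>(d + 1)/p = r\<close>.

  Hence \<open>Q = r\<Delta> - t\<close> has vertices \<open>w\<^sub>i = r v\<^sub>i - t\<close> with \<open>\<Sum> \<beta>\<^sub>i w\<^sub>i = 0\<close> and \<open>\<Sum> \<beta>\<^sub>i = 1\<close> for
  \<open>\<beta>\<^sub>i = x\<^sub>i / r > 0\<close>. For every simplex in this position the volume product is determined by the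
  coordinates of the origin:
  \<open>Vol(Q) \<cdot> Vol(Q\<^sup>\<or>) \<cdot> \<Prod> \<beta>\<^sub>i = 1\<close> (\<open>volume_product_simplex_dual\<close>). As \<open>Vol(Q) = r\<^sup>d p\<^sup>2\<close>, this gives
  \<open>Vol(Q\<^sup>\<or>) \<cdot> p\<^sup>2 \<cdot> \<Prod> x\<^sub>i = r\<close>, and the two claims follow from \<open>\<Prod> x\<^sub>i = (1/p)\<^sup>s (1/p\<^sup>2)\<^bsup>d-s+1\<^esup>\<close> and
  \<open>\<Prod> x\<^sub>i = (1/p)\<^bsup>d+1\<^esup>\<close> respectively.

  For the volume product, single out a vertex \<open>w\<^sub>k\<close>. The volume of \<open>Q\<close> is \<open>\<bar>det (w\<^sub>j - w\<^sub>k)\<bar>\<close>, and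
  \<open>w\<^sub>k\<close> being a combination of the other \<open>w\<^sub>j\<close> this equals \<open>\<bar>det (w\<^sub>j)\<bar> / \<beta>\<^sub>k\<close>
  (\<open>det_subtract_combination\<close>). The affine map \<open>y \<mapsto> (\<beta>\<^sub>j (1 - w\<^sub>j \<bullet> y))\<^sub>j\<close>, whose linear part has
  determinant \<open>\<plusminus> \<Prod>\<^sub>j \<beta>\<^sub>j \<cdot> det (w\<^sub>j)\<close>, takes \<open>Q\<^sup>\<or>\<close> to the standard simplex.\<close>

section \<open>Determinants with a combination of the rows subtracted from each row\<close>

lemma det_subtract_row:
  fixes A :: "real^'n^'n"
  assumes "finite J" "k \<notin> J"
  shows "det (\<chi> i. if i \<in> J then A $ i - A $ k else A $ i) = det A"
  using assms
proof (induction J)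
  case empty
  then show ?case by simp
next
  case (insert m J)
  let ?B = "(\<chi> i. if i \<in> J then A $ i - A $ k else A $ i)"
  have "(\<chi> i. if i \<in> insert m J then A $ i - A $ k else A $ i)
      = (\<chi> i. if i = m then row m ?B + (-1) *s row k ?B else row i ?B)"
    using insert by (auto simp: vec_eq_iff row_def)
  moreover have "m \<noteq> k" using insert by auto
  ultimately show ?case using insert det_row_operation[of m k ?B "-1"] by simp
qed

lemma det_row_combination:
  fixes A :: "real^'n^'n"
  shows "det (\<chi> i. if i = k then (\<Sum>j\<in>UNIV. g j *\<^sub>R A $ j) else A $ i) = g k * det A"
  using cramer_lemma_transpose[of k "\<chi> i. g i" A]
  by (simp add: row_def vec_nth_inverse scalar_mult_eq_scaleR cong: if_cong)

text \<open>The determinant is multilinear, and a term in which \<open>x\<close> replaces two rows vanishes. So only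
  the terms with \<open>x\<close> in at most one row remain; with \<open>x\<close> in row \<open>i\<close>, Cramer's rule
  (\<open>det_row_combination\<close>) gives \<open>g i * det A\<close>.\<close>

lemma det_subtract_combination:
  fixes A :: "real^'n^'n" and g :: "'n \<Rightarrow> real"
  defines "x \<equiv> (\<Sum>j\<in>UNIV. g j *\<^sub>R A $ j)"
  shows "det (\<chi> i. A $ i - x) = (1 - sum g UNIV) * det A"
proof -
  \<comment> \<open>The subtraction is carried out one row at a time; \<open>J\<close> is the set of rows already treated.\<close>
  have "det (\<chi> i. if i \<in> J then A $ i - x else A $ i) = (1 - sum g J) * det A"
    if "finite J" for J :: "'n set"
    using that
  proof (induction J)
    case empty
    then show ?case by simp
  next
    case (insert m J)
    let ?C = "(\<chi> i. if i = m then x else A $ i)"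
    have "(\<chi> i. if i = m then x else if i \<in> J then A $ i - x else A $ i)
        = (\<chi> i. if i \<in> J then ?C $ i - ?C $ m else ?C $ i)"
      using insert by (auto simp: vec_eq_iff)
    then have "det (\<chi> i. if i = m then x else if i \<in> J then A $ i - x else A $ i) = det ?C"
      using insert det_subtract_row[of J m ?C] by simp
    also have "\<dots> = g m * det A" unfolding x_def by (rule det_row_combination)
    finally have 1: "det (\<chi> i. if i = m then x else if i \<in> J then A $ i - x else A $ i) = g m * det A" .
    let ?D = "\<lambda>y. det (\<chi> i. if i = m then y i else if i \<in> J then A $ i - x else A $ i)"
    have 2: "?D (\<lambda>i. A $ i) = det (\<chi> i. if i \<in> J then A $ i - x else A $ i)"
      using insert by (intro arg_cong[where f = det]) (auto simp: vec_eq_iff)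
    have 3: "?D (\<lambda>i. A $ i - x) = det (\<chi> i. if i \<in> insert m J then A $ i - x else A $ i)"
      by (intro arg_cong[where f = det]) (auto simp: vec_eq_iff)
    have "?D (\<lambda>i. (A $ i - x) + x) = ?D (\<lambda>i. A $ i - x) + ?D (\<lambda>i. x)"
      by (rule det_row_add)
    then have "?D (\<lambda>i. A $ i) = ?D (\<lambda>i. A $ i - x) + g m * det A"
      unfolding 1 diff_add_cancel .
    then have "(1 - sum g J) * det A
        = det (\<chi> i. if i \<in> insert m J then A $ i - x else A $ i) + g m * det A"
      unfolding 2 3 insert.IH .
    then show ?case using insert by (simp add: algebra_simps)
  qed
  from this[of UNIV] show ?thesis by simp
qed

section \<open>The volume product of a simplex and its dual\<close>

lemma dual_polytope_convex_hull:
  "dual_polytope (convex hull X) = {y. \<forall>x\<in>X. x \<bullet> y \<le> 1}"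
proof -
  have "convex hull X \<subseteq> {x. y \<bullet> x \<le> 1}" if "\<forall>x\<in>X. x \<bullet> y \<le> 1" for y
    using that by (intro hull_minimal convex_halfspace_le) (auto simp: inner_commute)
  then show ?thesis
    by (fastforce simp: dual_polytope_def inner_commute intro: hull_inc)
qed

lemma Basis_cart: "(Basis :: (real^'n::finite) set) = range (\<lambda>i. axis i 1)"
  by (auto simp: Basis_vec_def)

lemma inj_axis: "inj (\<lambda>i::'n::finite. axis i (1::real))"
  by (auto simp: inj_def axis_eq_axis)

lemma std_simplex_cart:
  "convex hull (insert 0 Basis) = {x::real^'n. (\<forall>i. 0 \<le> x $ i) \<and> (\<Sum>i\<in>UNIV. x $ i) \<le> 1}"
  unfolding std_simplex by (simp add: Basis_cart sum.reindex[OF inj_axis] inner_axis)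

text \<open>The volume of a simplex and the effect of a linear map on Lebesgue measure, which both enter
  here, are stated for well-ordered index types; \<open>volume_product_simplex_dual\<close> transfers the
  result to an arbitrary finite index type.\<close>

lemma volume_product_simplex_dual_wellorder:
  fixes w :: "'i \<Rightarrow> real^'n::{finite,wellorder}"
  assumes I: "finite I" "card I = Suc CARD('n)" and w: "inj_on w I"
    and b: "\<And>i. i \<in> I \<Longrightarrow> b i > 0" "sum b I = 1" "(\<Sum>i\<in>I. b i *\<^sub>R w i) = 0"
    and nz: "normalized_volume (convex hull (w ` I)) \<noteq> 0"
  shows "normalized_volume (convex hull (w ` I))
       * normalized_volume (dual_polytope (convex hull (w ` I))) * prod b I = 1"
proof -
  obtain k where k: "k \<in> I" using I by fastforce
  have "card (UNIV :: 'n set) = card (I - {k})" using I k by simp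
  then obtain e where e: "bij_betw e (UNIV::'n set) (I - {k})"
    using I finite_same_card_bij by (metis finite_Diff finite_class.finite_UNIV)
  have eI: "e j \<in> I" for j using e by (auto simp: bij_betw_def)
  have sumI: "(\<Sum>i\<in>I. h i) = h k + (\<Sum>j\<in>UNIV. h (e j))" for h :: "'i \<Rightarrow> 'b::comm_monoid_add"
    using I k by (simp add: sum.remove[of I k] sum.reindex_bij_betw[OF e])
  have prodI: "prod b I = b k * (\<Prod>j\<in>UNIV. b (e j))"
    using I k by (simp add: prod.remove[of I k] prod.reindex_bij_betw[OF e])
  have ballI: "(\<forall>i\<in>I. P i) \<longleftrightarrow> P k \<and> (\<forall>j. P (e j))" for P
  proof -
    have "I = insert k (range e)" using e k by (auto simp: bij_betw_def)
    then show ?thesis by auto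
  qed
  have bk: "b k > 0" using b k by auto
  have sumb: "(\<Sum>j\<in>UNIV. b (e j)) = 1 - b k" using b sumI[of b] by simp
  have sumw: "(\<Sum>j\<in>UNIV. b (e j) *\<^sub>R w (e j)) = - (b k *\<^sub>R w k)"
    using b(3) sumI[of "\<lambda>i. b i *\<^sub>R w i"] by (simp add: eq_neg_iff_add_eq_0 add.commute)
  define A where "A = (\<chi> j. w (e j))"
  define M where "M = (\<chi> i. \<chi> j. w (e j) $ i - w k $ i)"
  let ?Q = "convex hull (w ` I)"
  have vol: "normalized_volume ?Q = \<bar>det M\<bar>"
  proof -
    have "bij_betw (w \<circ> e) UNIV (w ` (I - {k}))"
      by (rule bij_betw_trans[OF e]) (use w in \<open>auto intro: bij_betw_imageI inj_on_diff\<close>)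
    moreover have "w ` (I - {k}) = w ` I - {w k}"
      using inj_on_image_set_diff[OF w, of I "{k}"] k by auto
    ultimately have "measure lborel ?Q = \<bar>det M\<bar> / fact CARD('n)"
      unfolding M_def using content_simplex[of "w ` I" "w k" "w \<circ> e"] I w k
      by (simp add: card_image)
    moreover have "measure lebesgue ?Q = measure lborel ?Q"
      by (intro measure_completion) (simp add: I finite_imp_compact_convex_hull compact_imp_closed)
    ultimately show ?thesis by (simp add: normalized_volume_def)
  qed
  have detM: "det M = det A / b k"
  proof -
    \<comment> \<open>the coefficients of \<open>w k\<close> in terms of the other vertices\<close>
    define g where "g = (\<lambda>j. - b (e j) / b k)"
    have "(\<Sum>j\<in>UNIV. g j *\<^sub>R A $ j) = (-1 / b k) *\<^sub>R (\<Sum>j\<in>UNIV. b (e j) *\<^sub>R w (e j))"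
      by (simp add: g_def A_def scaleR_sum_right)
    also have "\<dots> = w k" using bk by (simp add: sumw)
    finally have g: "(\<Sum>j\<in>UNIV. g j *\<^sub>R A $ j) = w k" .
    have "sum g UNIV = - (\<Sum>j\<in>UNIV. b (e j)) / b k"
      by (simp add: g_def sum_negf sum_divide_distrib)
    then have "1 - sum g UNIV = 1 / b k" using bk by (simp add: sumb field_simps)
    moreover have "M = transpose (\<chi> j. A $ j - w k)"
      by (simp add: M_def A_def transpose_def vec_eq_iff)
    ultimately show ?thesis using det_subtract_combination[of A g] by (simp add: g)
  qed
  \<comment> \<open>\<open>c + L y\<close> has the coordinates \<open>b\<^sub>j (1 - w\<^sub>j \<bullet> y)\<close>, and their sum is
    \<open>1 - b\<^sub>k (1 - w\<^sub>k \<bullet> y)\<close>. So \<open>w\<^sub>j \<bullet> y \<le> 1\<close> says that a coordinate is nonnegative, and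
    \<open>w\<^sub>k \<bullet> y \<le> 1\<close> that the coordinates add up to at most 1.\<close>
  define L where "L = (\<lambda>y. (\<chi> j. (- b (e j)) *s w (e j)) *v y)"
  have linL: "linear L" unfolding L_def by (rule matrix_vector_mul_linear)
  have Lj: "L y $ j = - b (e j) * (w (e j) \<bullet> y)" for y j
    by (simp add: L_def matrix_vector_mult_def inner_vec_def sum_distrib_left mult.assoc)
  have detL: "\<bar>det (matrix L)\<bar> = (\<Prod>j\<in>UNIV. b (e j)) * \<bar>det A\<bar>"
    unfolding L_def matrix_of_matrix_vector_mul det_rows_mul A_def
    using b(1)[OF eI] by (simp add: abs_mult abs_prod less_imp_le)
  have "det (matrix L) \<noteq> 0"
  proof -
    have "det A \<noteq> 0" using nz vol detM by auto
    moreover have "(\<Prod>j\<in>UNIV. b (e j)) \<noteq> 0" using b(1)[OF eI] by (simp add: less_imp_neq[symmetric])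
    ultimately show ?thesis using detL by auto
  qed
  then have "inj L" using det_nz_iff_inj[OF linL] by simp
  then obtain L' where L': "linear L'" "\<And>x. L' (L x) = x" "\<And>x. L (L' x) = x"
    using linear_injective_isomorphism[OF linL] by auto
  let ?S = "convex hull (insert 0 Basis) :: (real^'n::{finite,wellorder}) set"
  define c where "c = (\<chi> j. b (e j))"
  let ?D = "dual_polytope ?Q"
  have dual: "y \<in> ?D \<longleftrightarrow> c + L y \<in> ?S" for y
  proof -
    have "(\<Sum>j\<in>UNIV. b (e j) * (w (e j) \<bullet> y)) = (\<Sum>j\<in>UNIV. b (e j) *\<^sub>R w (e j)) \<bullet> y"
      by (simp add: inner_sum_left)
    also have "\<dots> = - (b k * (w k \<bullet> y))" by (simp add: sumw)
    finally have "(\<Sum>j\<in>UNIV. (c + L y) $ j) = 1 - b k + b k * (w k \<bullet> y)"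
      by (simp add: c_def Lj sum_subtractf sumb)
    then have "(\<Sum>j\<in>UNIV. (c + L y) $ j) \<le> 1 \<longleftrightarrow> w k \<bullet> y \<le> 1"
      using mult_le_cancel_left_pos[OF bk, of "w k \<bullet> y" 1] by auto
    moreover have "0 \<le> (c + L y) $ j \<longleftrightarrow> w (e j) \<bullet> y \<le> 1" for j
      using mult_le_cancel_left_pos[OF b(1)[OF eI], of j "w (e j) \<bullet> y" 1] by (simp add: c_def Lj)
    ultimately show ?thesis
      by (auto simp: dual_polytope_convex_hull std_simplex_cart ballI)
  qed
  define T where "T = (+) (- c) ` ?S"
  have "x \<in> T \<longleftrightarrow> c + x \<in> ?S" for x unfolding T_def by (force simp: image_iff)
  then have D: "y \<in> ?D \<longleftrightarrow> L y \<in> T" for y using dual by simp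
  then have LD: "L ` ?D = T" and DL: "?D = L' ` T"
    by (auto simp: image_iff L' D) (metis L'(3) D L'(2))+
  have cS: "compact ?S" by (intro finite_imp_compact_convex_hull) auto
  then have "compact T" unfolding T_def by (intro compact_translation)
  then have "compact (L' ` T)"
    by (intro compact_continuous_image linear_continuous_on) (use L'(1) linear_linear in auto)
  then have "?D \<in> lmeasurable" unfolding DL by (rule lmeasurable_compact)
  then have "measure lebesgue T = \<bar>det (matrix L)\<bar> * measure lebesgue ?D"
    using measure_linear_image[OF linL] LD by metis
  moreover have "measure lebesgue T = measure lebesgue ?S" unfolding T_def by (rule measure_translation)
  moreover have "measure lebesgue ?S = measure lborel ?S"
    using compact_imp_closed[OF cS] by (intro measure_completion) simp
  moreover have "measure lborel ?S = 1 / fact CARD('n)" by (simp add: content_std_simplex)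
  ultimately have "\<bar>det (matrix L)\<bar> * measure lebesgue ?D = 1 / fact CARD('n)"
    by simp
  then have "\<bar>det (matrix L)\<bar> * normalized_volume ?D = 1"
    by (simp add: normalized_volume_def field_simps)
  moreover have "\<bar>det M\<bar> * b k = \<bar>det A\<bar>" using bk by (simp add: detM)
  ultimately have "(\<Prod>j\<in>UNIV. b (e j)) * (\<bar>det M\<bar> * b k) * normalized_volume ?D = 1"
    by (simp only: detL)
  then show ?thesis unfolding vol prodI by (simp only: ac_simps)
qed


section \<open>Transfer to arbitrary finite index types\<close>

lemma lborel_reindex:
  fixes g :: "'m::finite \<Rightarrow> 'n::finite"
  assumes g: "bij g"
  shows "distr lborel borel (\<lambda>x::real^'n. \<chi> i. x $ g i) = (lborel :: (real^'m) measure)"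
proof (rule lborel_eqI[symmetric])
  let ?h = "\<lambda>x::real^'n. (\<chi> i. x $ g i) :: real^'m"
  have [measurable]: "?h \<in> borel \<rightarrow>\<^sub>M borel"
    by (intro borel_measurable_continuous_onI continuous_intros)
  fix l u :: "real^'m" assume le: "\<And>b. b \<in> Basis \<Longrightarrow> l \<bullet> b \<le> u \<bullet> b"
  have le': "l $ i \<le> u $ i" for i using le[of "axis i 1"] by (simp add: inner_axis)
  let ?k = "\<lambda>x::real^'m. (\<chi> i. x $ inv_into UNIV g i) :: real^'n"
  have ginv: "g (inv_into UNIV g i) = i" "inv_into UNIV g (g j) = j" for i j
    using g by (simp_all add: bij_is_surj surj_f_inv_f bij_is_inj)
  have vimage: "?h -` box l u = box (?k l) (?k u)"
    by (auto simp: mem_box_cart ginv) (metis ginv)+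
  have prodB: "(\<Prod>b\<in>Basis. x \<bullet> b) = (\<Prod>i\<in>UNIV. x $ i)" for x :: "real^'k::finite"
    by (simp add: Basis_cart prod.reindex[OF inj_axis] inner_axis)
  have "emeasure (distr lborel borel ?h) (box l u) = emeasure lborel (box (?k l) (?k u))"
    by (simp add: emeasure_distr vimage)
  also have "\<dots> = (\<Prod>b\<in>Basis. (?k u - ?k l) \<bullet> b)"
    by (rule emeasure_lborel_box) (auto simp: Basis_vec_def inner_axis le')
  also have "(\<Prod>b\<in>Basis. (?k u - ?k l) \<bullet> b) = (\<Prod>i\<in>UNIV. (u - l) $ inv_into UNIV g i)"
    unfolding prodB by simp
  also have "\<dots> = (\<Prod>i\<in>UNIV. (u - l) $ i)"
    by (rule prod.reindex_bij_betw[OF bij_imp_bij_inv[OF g]])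
  finally show "emeasure (distr lborel borel ?h) (box l u) = (\<Prod>b\<in>Basis. (u - l) \<bullet> b)"
    unfolding prodB .
qed simp

lemma measure_lebesgue_reindex:
  fixes g :: "'m::finite \<Rightarrow> 'n::finite" and S :: "(real^'n) set"
  assumes g: "bij g" and S: "closed S"
  shows "measure lebesgue ((\<lambda>x. \<chi> i. x $ g i) ` S) = measure lebesgue S"
proof -
  let ?h = "\<lambda>x::real^'n. (\<chi> i. x $ g i) :: real^'m"
  let ?k = "\<lambda>x::real^'m. (\<chi> i. x $ inv_into UNIV g i) :: real^'n"
  have kh: "?k (?h x) = x" "?h (?k y) = y" for x y
    using g by (simp_all add: bij_is_surj surj_f_inv_f bij_is_inj)
  have [measurable]: "?h \<in> borel \<rightarrow>\<^sub>M borel"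
    by (intro borel_measurable_continuous_onI continuous_intros)
  have img: "?h ` S = ?k -` S" using kh by (auto simp: image_iff) (metis kh(2))
  have "closed (?k -` S)" using S by (intro closed_vimage continuous_intros)
  then have closed: "closed (?h ` S)" unfolding img .
  have "measure lebesgue (?h ` S) = measure lborel (?h ` S)"
    using closed by (intro measure_completion) auto
  also have "\<dots> = measure (distr lborel borel ?h) (?h ` S)"
    by (simp add: lborel_reindex[OF g])
  also have "\<dots> = measure lborel (?h -` ?h ` S)"
    using closed by (subst measure_distr) auto
  also have "?h -` ?h ` S = S"
    by (rule inj_vimage_image_eq, rule inj_on_inverseI[of UNIV ?k]) (rule kh(1))
  also have "measure lborel S = measure lebesgue S"
    using S by (intro measure_completion[symmetric]) auto
  finally show ?thesis .
qed

text \<open>A well-ordered type with as many elements as the given finite type.\<close>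

typedef ('a::finite) ordered_index = "{..<CARD('a)}"
  by (rule exI[of _ 0]) (simp add: zero_less_card_finite)

lemma card_ordered_index: "CARD('a::finite ordered_index) = CARD('a)"
  using type_definition.card[OF type_definition_ordered_index[where 'a='a]] by simp

instance ordered_index :: (finite) finite
proof
  show "finite (UNIV :: 'a ordered_index set)"
    by (rule card_ge_0_finite) (simp add: card_ordered_index zero_less_card_finite)
qed

instantiation ordered_index :: (finite) wellorder
begin

definition "x \<le> y \<longleftrightarrow> Rep_ordered_index x \<le> Rep_ordered_index y"
definition "x < y \<longleftrightarrow> Rep_ordered_index x < Rep_ordered_index y"

instance
proof
  fix P and x :: "'a ordered_index"
  assume step: "\<And>x::'a ordered_index. (\<And>y. y < x \<Longrightarrow> P y) \<Longrightarrow> P x"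
  show "P x"
  proof (induction x rule: measure_induct_rule[of Rep_ordered_index])
    case (less x)
    then show ?case by (rule step) (simp add: less_ordered_index_def)
  qed
qed (auto simp: less_eq_ordered_index_def less_ordered_index_def Rep_ordered_index_inject)

end

text \<open>Renaming the coordinates preserves convex hulls, inner products and volumes, hence also duals
  and the volume product.\<close>

lemma volume_product_simplex_dual:
  fixes w :: "'i \<Rightarrow> real^'n::finite"
  assumes I: "finite I" "card I = Suc CARD('n)" and w: "inj_on w I"
    and b: "\<And>i. i \<in> I \<Longrightarrow> b i > 0" "sum b I = 1" "(\<Sum>i\<in>I. b i *\<^sub>R w i) = 0"
    and nz: "normalized_volume (convex hull (w ` I)) \<noteq> 0"
  shows "normalized_volume (convex hull (w ` I))
       * normalized_volume (dual_polytope (convex hull (w ` I))) * prod b I = 1"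
proof -
  obtain g :: "'n ordered_index \<Rightarrow> 'n" where g: "bij g"
    using finite_same_card_bij[of "UNIV :: 'n ordered_index set" "UNIV :: 'n set"]
    by (auto simp: card_ordered_index)
  define h :: "real^'n \<Rightarrow> real^'n ordered_index" where "h = (\<lambda>x. \<chi> i. x $ g i)"
  have linh: "linear h" by (intro linearI) (auto simp: h_def vec_eq_iff)
  have injh: "inj h" using g
    by (auto simp: h_def inj_def vec_eq_iff) (metis bij_pointE)
  have "h (\<chi> i. y $ inv_into UNIV g i) = y" for y using g by (simp add: h_def bij_is_inj)
  then have surjh: "surj h" by (rule surjI)
  have inner_h: "h x \<bullet> h y = x \<bullet> y" for x y
    unfolding h_def inner_vec_def using sum.reindex_bij_betw[OF g, of "\<lambda>i. x $ i \<bullet> y $ i"] by simp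
  have vol_h: "normalized_volume (h ` S) = normalized_volume S" if "closed S" for S
    unfolding normalized_volume_def h_def measure_lebesgue_reindex[OF g that]
    by (simp add: card_ordered_index)
  let ?Q = "convex hull (w ` I)"
  have hQ: "convex hull ((h \<circ> w) ` I) = h ` ?Q"
    by (simp only: image_comp convex_hull_linear_image[OF linh])
  have dual_h: "dual_polytope (h ` ?Q) = h ` dual_polytope ?Q"
  proof (rule Set.set_eqI)
    fix z
    obtain y where z: "z = h y" using surjh by (metis surjD)
    have "z \<in> dual_polytope (h ` ?Q) \<longleftrightarrow> y \<in> dual_polytope ?Q"
      by (simp add: z dual_polytope_def inner_h)
    then show "z \<in> dual_polytope (h ` ?Q) \<longleftrightarrow> z \<in> h ` dual_polytope ?Q"
      by (simp add: z inj_image_mem_iff[OF injh])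
  qed
  have "closed ?Q" by (simp add: I finite_imp_compact_convex_hull compact_imp_closed)
  have "dual_polytope ?Q = (\<Inter>x\<in>?Q. {y. x \<bullet> y \<le> 1})" by (auto simp: dual_polytope_def)
  then have "closed (dual_polytope ?Q)" by (auto intro: closed_halfspace_le)
  have "normalized_volume (convex hull ((h \<circ> w) ` I))
      * normalized_volume (dual_polytope (convex hull ((h \<circ> w) ` I))) * prod b I = 1"
  proof (rule volume_product_simplex_dual_wellorder)
    show "inj_on (h \<circ> w) I" using w injh by (auto intro: comp_inj_on inj_on_subset)
    show "(\<Sum>i\<in>I. b i *\<^sub>R (h \<circ> w) i) = 0"
      using arg_cong[OF b(3), of h] by (simp add: linear_sum[OF linh] linear_cmul[OF linh] linear_0[OF linh])
    show "normalized_volume (convex hull (h \<circ> w) ` I) \<noteq> 0"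
      unfolding hQ vol_h[OF \<open>closed ?Q\<close>] by (rule nz)
  qed (use I b in \<open>auto simp: card_ordered_index\<close>)
  then show ?thesis
    unfolding hQ dual_h vol_h[OF \<open>closed ?Q\<close>] vol_h[OF \<open>closed (dual_polytope ?Q)\<close>] .
qed

section \<open>The torus and the group of a lattice simplex\<close>

lemma normal_Ints: "\<int> \<lhd> real_add_group"
proof -
  have comm: "comm_group real_add_group"
    by (rule comm_groupI) (auto simp: real_add_group_def intro: exI[of _ "- x" for x])
  then interpret comm_group real_add_group .
  have inv: "inv\<^bsub>real_add_group\<^esub> x = - x" for x
    by (rule inv_equality) (auto simp: real_add_group_def)
  have "subgroup \<int> real_add_group"
    by (rule subgroup.intro) (auto simp: inv, auto simp: real_add_group_def)
  then show ?thesis by (rule subgroup_imp_normal)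
qed

lemma coset_Ints: "\<int> #>\<^bsub>real_add_group\<^esub> x = {x + h |h. h \<in> \<int>}"
  by (auto simp: r_coset_def real_add_group_def add.commute)

lemma to_torus_add:
  "to_torus d x \<otimes>\<^bsub>torus d\<^esub> to_torus d y = to_torus d (\<lambda>i. x i + y i)"
  using normal.rcos_sum[OF normal_Ints]
  by (auto simp: torus_def to_torus_def real_add_group_def fun_eq_iff)

lemma to_torus_eqD:
  assumes "to_torus d x = to_torus d y" "i \<le> d"
  shows "x i - y i \<in> \<int>"
proof -
  have "\<int> #>\<^bsub>real_add_group\<^esub> x i = \<int> #>\<^bsub>real_add_group\<^esub> y i"
    using fun_cong[OF assms(1), of i] assms(2) by (simp add: to_torus_def)
  moreover have "x i \<in> \<int> #>\<^bsub>real_add_group\<^esub> x i" by (force simp: coset_Ints)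
  ultimately show ?thesis by (auto simp: coset_Ints)
qed

lemma to_torus_eqI:
  assumes "\<And>i. i \<le> d \<Longrightarrow> x i - y i \<in> \<int>"
  shows "to_torus d x = to_torus d y"
  unfolding to_torus_def
proof (rule restrict_ext)
  fix i assume "i \<in> {0..d}"
  then have i: "x i - y i \<in> \<int>" using assms by simp
  have "x i + h = y i + (h + (x i - y i))" "y i + h = x i + (h - (x i - y i))" for h by simp_all
  then show "\<int> #>\<^bsub>real_add_group\<^esub> x i = \<int> #>\<^bsub>real_add_group\<^esub> y i"
    using i unfolding coset_Ints by (blast intro: Ints_add Ints_diff)
qed

text \<open>Membership in \<open>Lambda v\<close> provides only some lift \<open>y\<close> of the class of \<open>x\<close> with
  \<open>\<Sum> y\<^sub>i v\<^sub>i\<close> integral; as \<open>x - y\<close> and the \<open>v\<^sub>i\<close> are integral, \<open>x\<close> serves as well.\<close>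

lemma Lambda_lift_sum:
  fixes v :: "nat \<Rightarrow> real^'n::finite"
  assumes "to_torus CARD('n) x \<in> Lambda v" and v: "\<And>i. i \<le> CARD('n) \<Longrightarrow> v i \<in> int_lattice"
  shows "(\<Sum>i=0..CARD('n). x i *\<^sub>R v i) \<in> int_lattice"
proof -
  obtain y where y: "to_torus CARD('n) x = to_torus CARD('n) y"
    and "(\<Sum>i=0..CARD('n). y i *\<^sub>R (v i, 1 :: real)) \<in> int_lattice \<times> \<int>"
    using assms(1) by (auto simp: Lambda_def)
  then have yv: "(\<Sum>i=0..CARD('n). y i *\<^sub>R v i) \<in> int_lattice"
    by (simp add: mem_Times_iff fst_sum)
  have lift: "(x i - y i) * v i $ j \<in> \<int>" if "i \<le> CARD('n)" for i j
    using to_torus_eqD[OF y that] v[OF that] by (simp add: int_lattice_def)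
  have "(\<Sum>i=0..CARD('n). x i *\<^sub>R v i) $ j \<in> \<int>" for j
  proof -
    have "(\<Sum>i=0..CARD('n). x i *\<^sub>R v i) $ j
        = (\<Sum>i=0..CARD('n). (x i - y i) * v i $ j) + (\<Sum>i=0..CARD('n). y i *\<^sub>R v i) $ j"
      unfolding sum_component sum.distrib[symmetric]
      by (rule sum.cong) (simp_all add: algebra_simps)
    moreover have "(\<Sum>i=0..CARD('n). (x i - y i) * v i $ j) \<in> \<int>"
      by (rule Ints_sum) (simp add: lift)
    moreover have "(\<Sum>i=0..CARD('n). y i *\<^sub>R v i) $ j \<in> \<int>"
      using yv unfolding int_lattice_def by blast
    ultimately show ?thesis by (simp only: Ints_add)
  qed
  then show ?thesis unfolding int_lattice_def by blast
qed

section \<open>The dual volume in terms of a positive lift\<close>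

text \<open>The point \<open>\<Sum> x\<^sub>i v\<^sub>i\<close> lies in the interior of \<open>r\<Delta>\<close> because its coordinates are positive and
  sum to \<open>r\<close>, and it is integral because \<open>x\<close> lifts an element of \<open>Lambda v\<close>. By uniqueness it is
  \<open>t\<close>, so the \<open>x\<^sub>i / r\<close> are the barycentric coordinates of the origin in \<open>r\<Delta> - t\<close>.\<close>

lemma normalized_volume_dual_simplex_of_lift:
  fixes \<Delta> :: "(real ^ 'n::finite) set"
  assumes r: "r > 0" and lat: "vertex_set \<Delta> \<subseteq> int_lattice" and simp: "int CARD('n) simplex \<Delta>"
    and nz: "normalized_volume \<Delta> \<noteq> 0"
    and t: "interior ((\<lambda>x. real r *\<^sub>R x) ` \<Delta>) \<inter> int_lattice = {t}"
    and v: "vertex_ordering \<Delta> v"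
    and x: "to_torus CARD('n) x \<in> Lambda v" "\<And>i. i \<le> CARD('n) \<Longrightarrow> x i > 0"
      "(\<Sum>i=0..CARD('n). x i) = real r"
  shows "normalized_volume (dual_polytope ((\<lambda>x. real r *\<^sub>R x - t) ` \<Delta>))
    * normalized_volume \<Delta> * (\<Prod>i=0..CARD('n). x i) = real r"
proof -
  obtain C where C: "\<not> affine_dependent C" "int (card C) = int CARD('n) + 1" "\<Delta> = convex hull C"
    using simp unfolding simplex_def by auto
  have VC: "vertex_set \<Delta> = C"
    unfolding vertex_set_def using extreme_point_of_convex_hull_affine_independent[OF C(1)] C(3) by auto
  let ?I = "{0..CARD('n)}"
  have bij: "bij_betw v ?I C" using v by (simp add: vertex_ordering_def VC)
  then have injv: "inj_on v ?I" and imv: "v ` ?I = C" by (auto simp: bij_betw_def)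
  have vI: "v i \<in> int_lattice" if "i \<le> CARD('n)" for i using lat that imv VC by force
  define b where "b = (\<lambda>i. x i / real r)"
  have b: "b i > 0" if "i \<in> ?I" for i using x(2) r that by (simp add: b_def)
  have sb: "sum b ?I = 1" using r x(3) by (simp add: b_def flip: sum_divide_distrib)
  let ?y = "\<Sum>i\<in>?I. b i *\<^sub>R v i"
  have ry: "real r *\<^sub>R ?y = (\<Sum>i\<in>?I. x i *\<^sub>R v i)" using r by (simp add: b_def scaleR_sum_right)
  have "?y \<in> rel_interior (convex hull C)"
    unfolding rel_interior_convex_hull_explicit[OF C(1)]
  proof (intro CollectI exI conjI ballI)
    let ?u = "\<lambda>c. b (the_inv_into ?I v c)"
    have u: "?u (v i) = b i" if "i \<in> ?I" for i using that injv by (simp add: the_inv_into_f_f)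
    show "0 < ?u c" if "c \<in> C" for c using that imv b u by (metis imageE)
    show "sum ?u C = 1" using sb u by (simp add: sum.reindex_bij_betw[OF bij, symmetric])
    show "(\<Sum>c\<in>C. ?u c *\<^sub>R c) = ?y" using u by (simp add: sum.reindex_bij_betw[OF bij, symmetric])
  qed
  moreover have "affine hull \<Delta> = UNIV"
    using C by (simp add: affine_hull_convex_hull affine_independent_span_gt)
  ultimately have "?y \<in> interior \<Delta>" using C(3) rel_interior_interior by metis
  moreover have "interior ((\<lambda>x. real r *\<^sub>R x) ` \<Delta>) = (\<lambda>x. real r *\<^sub>R x) ` interior \<Delta>"
    using r by (intro interior_injective_linear_image) (auto simp: inj_def linear_scaleR)
  ultimately have "real r *\<^sub>R ?y \<in> interior ((\<lambda>x. real r *\<^sub>R x) ` \<Delta>)" by auto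
  moreover have "real r *\<^sub>R ?y \<in> int_lattice" unfolding ry by (rule Lambda_lift_sum[OF x(1) vI])
  ultimately have ty: "t = real r *\<^sub>R ?y" using t by auto
  define w where "w = (\<lambda>i. real r *\<^sub>R v i - t)"
  let ?Q = "(\<lambda>x. real r *\<^sub>R x - t) ` \<Delta>"
  have Q: "?Q = convex hull (w ` ?I)"
    using convex_hull_affinity[of "- t" "real r" C] unfolding w_def imv[symmetric] C(3) 
    by (simp add: image_image)
  have volQ: "normalized_volume ?Q = real r ^ CARD('n) * normalized_volume \<Delta>"
    using measure_lebesgue_affine[of "real r" "- t" \<Delta>] by (simp add: normalized_volume_def)
  have "normalized_volume ?Q * normalized_volume (dual_polytope ?Q) * prod b ?I = 1"
    unfolding Q
  proof (rule volume_product_simplex_dual)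
    show "inj_on w ?I" using injv r by (auto simp: w_def inj_on_def)
    have "(\<Sum>i\<in>?I. b i *\<^sub>R w i) = real r *\<^sub>R ?y - sum b ?I *\<^sub>R t"
      by (simp add: w_def scaleR_diff_right sum_subtractf scaleR_sum_right scaleR_sum_left mult.commute)
    then show "(\<Sum>i\<in>?I. b i *\<^sub>R w i) = 0" by (simp add: sb ty)
    show "normalized_volume (convex hull (w ` ?I)) \<noteq> 0"
      using volQ nz r unfolding Q by simp
  qed (use b sb in auto)
  moreover have "prod b ?I = (\<Prod>i=0..CARD('n). x i) / real r ^ Suc CARD('n)"
    by (simp add: b_def prod_dividef)
  ultimately show ?thesis using r by (simp add: volQ field_simps)
qed

section \<open>Gorenstein simplices of normalized volume \<open>p\<^sup>2\<close>\<close>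

theorem corollary4p4:
  fixes \<Delta> :: "(real ^ 'n::finite) set" and p r :: nat and t :: "real ^ 'n"
  assumes "prime p"
    and "r > 0"
    and "gorenstein_simplex r \<Delta>"
    and "normalized_volume \<Delta> = real (p ^ 2)"
    and "interior ((\<lambda>x. real r *\<^sub>R x) ` \<Delta>) \<inter> int_lattice = {t}"
  shows
    "(\<forall>s::nat. s \<le> CARD('n) - 1 \<longrightarrow>
        int r * int p ^ 2 - 1 = (int CARD('n) - int s) + int p * int s \<longrightarrow>
        (\<exists>v. vertex_ordering \<Delta> v \<and>
           Lambda v = generate (torus CARD('n))
             {to_torus CARD('n) (\<lambda>i. if i < s then 1 / real p else 1 / real p ^ 2)}) \<longrightarrow>
        normalized_volume (dual_polytope ((\<lambda>x. real r *\<^sub>R x - t) ` \<Delta>))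
          = real r * real p ^ (2 * CARD('n) - s))
     \<and>
     (\<forall>(s::nat) (a :: nat \<Rightarrow> int).
        int CARD('n) = int r * int p - 1 \<longrightarrow>
        1 \<le> s \<longrightarrow> s \<le> CARD('n) - 1 \<longrightarrow>
        (\<forall>i\<in>{1..s-1}. 1 \<le> a i \<and> a i \<le> int p - 1) \<longrightarrow>
        (\<exists>v. vertex_ordering \<Delta> v \<and>
           Lambda v = generate (torus CARD('n))
             {to_torus CARD('n) (\<lambda>i.
                if i = 0 then (2 - of_int (\<Sum>j=1..s-1. a j)) / real p
                else if i < s then (of_int (a i) + 1) / real p
                else if i = s then 0
                else 1 / real p),
              to_torus CARD('n) (\<lambda>i.
                if i = 0 then (of_int (\<Sum>j=1..s-1. a j) - 1) / real p
                else if i < s then (real p - of_int (a i)) / real p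
                else if i = s then 1 / real p
                else 0)}) \<longrightarrow>
        normalized_volume (dual_polytope ((\<lambda>x. real r *\<^sub>R x - t) ` \<Delta>))
          = real r * real p ^ (CARD('n) - 1))"
proof -
  let ?d = "CARD('n)"
  have p: "p > 0" using assms(1) prime_gt_0_nat by blast
  have lat: "vertex_set \<Delta> \<subseteq> int_lattice" and simplex: "int ?d simplex \<Delta>"
    using assms(3) by (auto simp: gorenstein_simplex_def gorenstein_def lattice_polytope_def)
  have nz: "normalized_volume \<Delta> \<noteq> 0" using assms(4) p by simp
  note key = normalized_volume_dual_simplex_of_lift[OF assms(2) lat simplex nz assms(5), unfolded assms(4)]
  let ?V = "normalized_volume (dual_polytope ((\<lambda>x. real r *\<^sub>R x - t) ` \<Delta>))"
  have part1: "?V = real r * real p ^ (2 * ?d - s)"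
    if s: "s \<le> ?d - 1" and deg: "int r * int p ^ 2 - 1 = (int ?d - int s) + int p * int s"
      and v: "vertex_ordering \<Delta> v" and L: "Lambda v = generate (torus ?d)
        {to_torus ?d (\<lambda>i. if i < s then 1 / real p else 1 / real p ^ 2)}" for s v
  proof -
    define x where "x = (\<lambda>i::nat. if i < s then 1 / real p else 1 / real p ^ 2)"
    have sd: "s \<le> ?d" using s by simp
    have I: "{0..?d} = {0..<s} \<union> {s..?d}" "{0..<s} \<inter> {s..?d} = {}" using sd by auto
    have "real_of_int (int r * int p ^ 2 - 1) = real_of_int ((int ?d - int s) + int p * int s)"
      using deg by simp
    then have deg': "real r * real p ^ 2 = real p * real s + (real ?d - real s + 1)" by simp
    have "(\<Sum>i=0..?d. x i) = real s / real p + (real ?d - real s + 1) / real p ^ 2"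
      unfolding I(1) using I(2) sd
      by (subst sum.union_disjoint) (auto simp: x_def Suc_diff_le of_nat_diff algebra_simps)
    also have "\<dots> = (real p * real s + (real ?d - real s + 1)) / real p ^ 2"
      using p by (simp add: field_simps power2_eq_square)
    also have "\<dots> = real r" unfolding deg'[symmetric] using p by simp
    finally have sumx: "(\<Sum>i=0..?d. x i) = real r" .
    have "(\<Prod>i=0..?d. x i) = (1 / real p) ^ s * (1 / real p ^ 2) ^ Suc (?d - s)"
      unfolding I(1) using I(2) sd
      by (subst prod.union_disjoint) (auto simp: x_def Suc_diff_le)
    also have "\<dots> = 1 / real p ^ (s + 2 * Suc (?d - s))"
      by (simp add: power_add power_mult power_divide) (simp add: power2_eq_square)
    also have "s + 2 * Suc (?d - s) = (2 * ?d - s) + 2" using sd by simp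
    finally have prodx: "(\<Prod>i=0..?d. x i) = 1 / (real p ^ (2 * ?d - s) * real p ^ 2)" 
      unfolding power_add .
    have "to_torus ?d x \<in> Lambda v" unfolding L x_def by (rule generate.incl) simp
    then have "?V * real (p ^ 2) * (\<Prod>i=0..?d. x i) = real r"
      by (rule key[OF v]) (use sumx p in \<open>auto simp: x_def\<close>)
    then show ?thesis using p by (simp add: prodx field_simps)
  qed
  have part2: "?V = real r * real p ^ (?d - 1)"
    if d: "int ?d = int r * int p - 1"
      and v: "vertex_ordering \<Delta> v" and L: "Lambda v = generate (torus ?d) {to_torus ?d g, to_torus ?d h}"
      and gh: "\<And>i. i \<le> ?d \<Longrightarrow> 1 / real p - (g i + h i) \<in> \<int>" for v g h
  proof -
    have rp: "real r * real p = real ?d + 1"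
      using arg_cong[OF d, of real_of_int] by simp
    have "to_torus ?d (\<lambda>i. 1 / real p) = to_torus ?d (\<lambda>i. g i + h i)"
      by (rule to_torus_eqI) (rule gh)
    also have "\<dots> \<in> Lambda v"
      unfolding L to_torus_add[symmetric] by (intro generate.eng generate.incl) auto
    finally have "?V * real (p ^ 2) * (\<Prod>i=0..?d. 1 / real p) = real r"
      by (rule key[OF v]) (use rp p in \<open>auto simp: field_simps\<close>)
    moreover obtain m where "?d = Suc m" using not0_implies_Suc[of ?d] by auto
    ultimately show ?thesis using p by (simp add: field_simps power2_eq_square)
  qed
  show ?thesis
  proof (intro conjI allI impI; elim exE conjE)
    fix s v
    assume "s \<le> ?d - 1" "int r * int p ^ 2 - 1 = (int ?d - int s) + int p * int s"
      "vertex_ordering \<Delta> v" "Lambda v = generate (torus ?d)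
        {to_torus ?d (\<lambda>i. if i < s then 1 / real p else 1 / real p ^ 2)}"
    then show "?V = real r * real p ^ (2 * ?d - s)" by (rule part1)
  next
    fix s :: nat and a :: "nat \<Rightarrow> int" and v
    assume d: "int ?d = int r * int p - 1" and s: "1 \<le> s" and v: "vertex_ordering \<Delta> v"
      and L: "Lambda v = generate (torus CARD('n))
             {to_torus CARD('n) (\<lambda>i.
                if i = 0 then (2 - of_int (\<Sum>j=1..s-1. a j)) / real p
                else if i < s then (of_int (a i) + 1) / real p
                else if i = s then 0
                else 1 / real p),
              to_torus CARD('n) (\<lambda>i.
                if i = 0 then (of_int (\<Sum>j=1..s-1. a j) - 1) / real p
                else if i < s then (real p - of_int (a i)) / real p
                else if i = s then 1 / real p
                else 0)}"
    show "?V = real r * real p ^ (?d - 1)"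
      \<comment> \<open>The coordinates of the two generators add up to \<open>1/p\<close>, or to \<open>1 + 1/p\<close> for \<open>0 < i < s\<close>.\<close>
    proof (rule part2[OF d v L])
    qed (use p s in \<open>auto simp: field_simps\<close>)
  qed
qed

end
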